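(* Let $\mathbf x=(x^{i,j}_{s,k,a})$, with $x^{i,j}_{s,k,a}\in[0,1]$ for $i\in\mathcal N$, $j\in\mathcal J\cup\{0\}$, $k\in\{0,\dots,h-1\}$, $s\in\mathcal S^i$, $a\in\mathcal A^i$ (and $x^{i,j}_{s,0,a}=0$ for $s\ne s^i_0$), be a conditional plan satisfying the flow equations $$\sum_{a\in\mathcal A^i}x^{i,j}_{s,k,a}=\sum_{s'\in\mathcal S^i}\sum_{a\in\mathcal A^i}x^{i,j}_{s',k-1,a}\,\widetilde T^{i,j}(s',a,s),\qquad k=1,\dots,h-1,\ s\in\mathcal S^i,\ i\in\mathcal N,\ j\in\mathcal J\cup\{0\},$$ $$\sum_{a\in\mathcal A^i}x^{i,j}_{s^i_0,0,a}=1,\qquad i\in\mathcal N,\ j\in\mathcal J\cup\{0\}.$$ Then for every $j\in\mathcal J$ the execution risk at the initial joint state $s_0$ is the following linear function of $\mathbf x$: $$\mathrm{Er}^j(s_0)=\sum_{i\in\mathcal N}\widetilde r^{\,j}(s^i_0)+\sum_{k=1}^{h}\ \sum_{i\in\mathcal N}\ \sum_{s'\in\mathcal S^i}\ \sum_{a\in\mathcal A^i}\ \sum_{s\in\mathcal S^i}\widetilde r^{\,j}(s)\,x^{i,j}_{s',k-1,a}\,\widetilde T^{i,j}(s',a,s),$$ where $\mathrm{Er}^j(s_0)$ is computed under the policy given by $\mathbf x$.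
   Context: Setting. $\mathcal X$ is a finite set of agents. Each agent $v\in\mathcal X$ has finite state set $\mathcal S^v$, finite action set $\mathcal A^v$, transition function $T^v:\mathcal S^v\times\mathcal A^v\times\mathcal S^v\to[0,1]$ with $T^v(s^v,a^v,\bar s^v)=\Pr(\bar s^v\mid a^v,s^v)$ (so $T^v(s^v,a^v,\cdot)$ is a probability distribution), and initial state $s^v_0$. $\mathcal N$ is a finite set of interaction points; each $i\in\mathcal N$ has an agent set $\mathcal X^i\subseteq\mathcal X$, with $\mathcal X=\bigcup_{i\in\mathcal N}\mathcal X^i$. $\mathcal J$ is a finite set of risk criteria ($0\notin\mathcal J$) and $h\ge 1$ is the planning horizon. For $i\in\mathcal N$: $\mathcal S^i=\prod_{v\in\mathcal X^i}\mathcal S^v$, $\mathcal A^i=\prod_{v\in\mathcal X^i}\mathcal A^v$, $T^i(s^i,a^i,\bar s^i)=\prod_{v\in\mathcal X^i}T^v(s^v,a^v,\bar s^v)$, $s^i_0=(s^v_0)_{v\in\mathcal X^i}$; and $s_0=(s^v_0)_{v\in\mathcal X}$. For agents $v,v'$ and $j\in\mathcal J$, $r^j(s^v,s^{v'})\in[0,1]$ is the given probability of failure (e.g. collision) when $v$ is in state $s^v$ and $v'$ in state $s^{v'}$. For $j\in\mathcal J$ and $s=(s^v)_{v\in\mathcal X^i}\in\mathcal S^i$ put $$\widetilde r^{\,j}(s)=1-\prod_{\{v,v'\}\subseteq\mathcal X^i,\,v\ne v'}(1-r^j(s^v,s^{v'})),\qquad \widetilde T^{i,j}(s,a,\bar s)=T^i(s,a,\bar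 s)\prod_{\{v,v'\}\subseteq\mathcal X^i,\,v\ne v'}(1-r^j(s^v,s^{v'})),$$ and $\widetilde T^{i,0}=T^i$. Policy given by $\mathbf x$. For the criterion $j$ under consideration, at interaction point $i$ in state $s$ at time $k$, action $a\in\mathcal A^i$ is taken with probability $\pi^i(s,k,a)=x^{i,j}_{s,k,a}\big/\sum_{a'\in\mathcal A^i}x^{i,j}_{s,k,a'}$ (for $k=0$, $s=s^i_0$, this is $x^{i,j}_{s,0,a}$); where the denominator is $0$, $\pi^i(s,k,\cdot)$ is an arbitrary probability distribution on $\mathcal A^i$. The run at $i$, $S^i_0=s^i_0,S^i_1,\dots,S^i_h$ with $S^i_t=(S^v_t)_{v\in\mathcal X^i}$, is the Markov chain on $\mathcal S^i$ with $\Pr(S^i_{k+1}=\bar s\mid S^i_k=s)=\sum_{a\in\mathcal A^i}\pi^i(s,k,a)T^i(s,a,\bar s)$. Failures. At each time $t\in\{0,\dots,h\}$ and for each unordered pair of distinct agents $v,v'$ sharing an interaction point there is a Bernoulli failure variable $R^j(S^v_t,S^{v'}_t)$ with $\Pr(R^j(S^v_t,S^{v'}_t)=1\mid S^v_t=s^v,S^{v'}_t=s^{v'})=r^j(s^v,s^{v'})$. For each fixed $i$, conditionally on the run at $i$, the failure variables of the pairs in $\mathcal X^i$ are independent over all pairs and all times $t$ (so failures do not influence the transitions). Pairs of agents that share no interaction point never fail. Standing assumption. Any pair of agents may fail in at most one interaction point, and the failure events $F^j_i=\bigvee_{t=0}^{h}\bigvee_{v,v'\in\mathcal X^i}\{R^j(S^v_t,S^{v'}_t)=1\}$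 at different interaction points $i\in\mathcal N$ are mutually exclusive. Execution risk. $\mathrm{Er}^j(s_0)$ is the probability, given that the run starts in $s_0$, that some failure with respect to criterion $j$ occurs at some time $t\in\{0,\dots,h\}$ between some pair of agents: $$\mathrm{Er}^j(s_0)=\Pr\Bigl(\bigvee_{t=0}^{h}\ \bigvee_{i\in\mathcal N}\ \bigvee_{v,v'\in\mathcal X^i}R^j(S^v_t,S^{v'}_t)=1\ \Big|\ S_0=s_0\Bigr).$$ By the standing assumption it equals $\sum_{i\in\mathcal N}\Pr(F^j_i\mid S^i_0=s^i_0)$. *)

theory Defs
  imports "HOL-Probability.Probability" "HOL-Library.Uprod"
begin

text \<open>
  The failure probability of criterion \<open>j\<close> for agent \<open>v\<close> in state \<open>s\<close> and agent \<open>v'\<close> in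
  state \<open>s'\<close> is \<open>risk j (Upair (v, s) (v', s'))\<close>. Failures belong to unordered pairs of agents,
  so this quantity has to be symmetric, and taking it on unordered pairs makes it so.
\<close>

record ('v, 's, 'a, 'i, 'j) model =
  agents   :: "'v set"
  states   :: "'v \<Rightarrow> 's set"
  actions  :: "'v \<Rightarrow> 'a set"
  trans_pr :: "'v \<Rightarrow> 's \<Rightarrow> 'a \<Rightarrow> 's \<Rightarrow> real"
  init     :: "'v \<Rightarrow> 's"
  points   :: "'i set"
  members  :: "'i \<Rightarrow> 'v set"
  criteria :: "'j set"
  risk     :: "'j \<Rightarrow> ('v \<times> 's) uprod \<Rightarrow> real"
  horizon  :: nat

definition valid_model :: "('v, 's, 'a, 'i, 'j::zero) model \<Rightarrow> bool" where
  "valid_model m \<longleftrightarrow>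
     finite (agents m) \<and>
     (\<forall>v\<in>agents m. finite (states m v) \<and> finite (actions m v) \<and> init m v \<in> states m v) \<and>
     (\<forall>v\<in>agents m. \<forall>s\<in>states m v. \<forall>a\<in>actions m v.
        (\<forall>s'\<in>states m v. trans_pr m v s a s' \<in> {0..1}) \<and>
        (\<Sum>s'\<in>states m v. trans_pr m v s a s') = 1) \<and>
     finite (points m) \<and>
     agents m = (\<Union>i\<in>points m. members m i) \<and>
     finite (criteria m) \<and> 0 \<notin> criteria m \<and>
     (\<forall>j\<in>criteria m. \<forall>v\<in>agents m. \<forall>v'\<in>agents m. v \<noteq> v' \<longrightarrow>
        (\<forall>s\<in>states m v. \<forall>s'\<in>states m v'. risk m j (Upair (v, s) (v', s')) \<in> {0..1})) \<and>
     horizon m \<ge> 1"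

definition joint_states :: "('v, 's, 'a, 'i, 'j) model \<Rightarrow> 'i \<Rightarrow> ('v \<Rightarrow> 's) set" where
  "joint_states m i = (\<Pi>\<^sub>E v\<in>members m i. states m v)"

definition joint_actions :: "('v, 's, 'a, 'i, 'j) model \<Rightarrow> 'i \<Rightarrow> ('v \<Rightarrow> 'a) set" where
  "joint_actions m i = (\<Pi>\<^sub>E v\<in>members m i. actions m v)"

definition joint_init :: "('v, 's, 'a, 'i, 'j) model \<Rightarrow> 'i \<Rightarrow> 'v \<Rightarrow> 's" where
  "joint_init m i = restrict (init m) (members m i)"

definition joint_trans ::
  "('v, 's, 'a, 'i, 'j) model \<Rightarrow> 'i \<Rightarrow> ('v \<Rightarrow> 's) \<Rightarrow> ('v \<Rightarrow> 'a) \<Rightarrow> ('v \<Rightarrow> 's) \<Rightarrow> real" where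
  "joint_trans m i s a s' = (\<Prod>v\<in>members m i. trans_pr m v (s v) (a v) (s' v))"

definition pairs :: "('v, 's, 'a, 'i, 'j) model \<Rightarrow> 'i \<Rightarrow> 'v uprod set" where
  "pairs m i = {e. proper_uprod e \<and> set_uprod e \<subseteq> members m i}"

text \<open>For \<open>e = Upair v v'\<close> the following is \<open>risk m j (Upair (v, s v) (v', s v'))\<close>.\<close>

definition pair_risk :: "('v, 's, 'a, 'i, 'j) model \<Rightarrow> 'j \<Rightarrow> ('v \<Rightarrow> 's) \<Rightarrow> 'v uprod \<Rightarrow> real" where
  "pair_risk m j s e = risk m j (map_uprod (\<lambda>v. (v, s v)) e)"

lemma pair_risk_Upair [simp]:
  "pair_risk m j s (Upair v v') = risk m j (Upair (v, s v) (v', s v'))"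
  by (simp add: pair_risk_def)

definition joint_risk :: "('v, 's, 'a, 'i, 'j) model \<Rightarrow> 'i \<Rightarrow> 'j \<Rightarrow> ('v \<Rightarrow> 's) \<Rightarrow> real" where
  "joint_risk m i j s = 1 - (\<Prod>e\<in>pairs m i. 1 - pair_risk m j s e)"

definition safe_trans ::
  "('v, 's, 'a, 'i, 'j::zero) model \<Rightarrow> 'i \<Rightarrow> 'j \<Rightarrow> ('v \<Rightarrow> 's) \<Rightarrow> ('v \<Rightarrow> 'a) \<Rightarrow> ('v \<Rightarrow> 's) \<Rightarrow> real" where
  "safe_trans m i j s a s' =
     (if j = 0 then joint_trans m i s a s'
      else joint_trans m i s a s' * (\<Prod>e\<in>pairs m i. 1 - pair_risk m j s e))"

type_synonym ('v, 's, 'a, 'i, 'j) plan =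
  "'i \<Rightarrow> 'j \<Rightarrow> ('v \<Rightarrow> 's) \<Rightarrow> nat \<Rightarrow> ('v \<Rightarrow> 'a) \<Rightarrow> real"

definition conditional_plan ::
  "('v, 's, 'a, 'i, 'j::zero) model \<Rightarrow> ('v, 's, 'a, 'i, 'j) plan \<Rightarrow> bool" where
  "conditional_plan m x \<longleftrightarrow>
     (\<forall>i\<in>points m. \<forall>j\<in>criteria m \<union> {0}.
        (\<forall>s\<in>joint_states m i. \<forall>k<horizon m. \<forall>a\<in>joint_actions m i. x i j s k a \<in> {0..1}) \<and>
        (\<forall>s\<in>joint_states m i. \<forall>a\<in>joint_actions m i. s \<noteq> joint_init m i \<longrightarrow> x i j s 0 a = 0) \<and>
        (\<forall>k\<in>{1..horizon m - 1}. \<forall>s\<in>joint_states m i.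
           (\<Sum>a\<in>joint_actions m i. x i j s k a) =
           (\<Sum>s'\<in>joint_states m i. \<Sum>a\<in>joint_actions m i.
              x i j s' (k - 1) a * safe_trans m i j s' a s)) \<and>
        (\<Sum>a\<in>joint_actions m i. x i j (joint_init m i) 0 a) = 1)"

type_synonym ('v, 's, 'a, 'i) policy = "'i \<Rightarrow> ('v \<Rightarrow> 's) \<Rightarrow> nat \<Rightarrow> ('v \<Rightarrow> 'a) \<Rightarrow> real"

definition policy_given_by ::
  "('v, 's, 'a, 'i, 'j) model \<Rightarrow> ('v, 's, 'a, 'i, 'j) plan \<Rightarrow> 'j \<Rightarrow> ('v, 's, 'a, 'i) policy \<Rightarrow> bool"
where
  "policy_given_by m x j pol \<longleftrightarrow>
     (\<forall>i\<in>points m. \<forall>s\<in>joint_states m i. \<forall>k<horizon m.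
        if (\<Sum>a'\<in>joint_actions m i. x i j s k a') \<noteq> 0
        then \<forall>a\<in>joint_actions m i.
               pol i s k a = x i j s k a / (\<Sum>a'\<in>joint_actions m i. x i j s k a')
        else (\<forall>a\<in>joint_actions m i. pol i s k a \<ge> 0) \<and> (\<Sum>a\<in>joint_actions m i. pol i s k a) = 1)"

definition run_at ::
  "('v, 's, 'a, 'i, 'j) model \<Rightarrow> (nat \<Rightarrow> 'v \<Rightarrow> 'w \<Rightarrow> 's) \<Rightarrow> 'i \<Rightarrow> nat \<Rightarrow> 'w \<Rightarrow> 'v \<Rightarrow> 's" where
  "run_at m S i t \<omega> = restrict (\<lambda>v. S t v \<omega>) (members m i)"

text \<open>
  The run at \<open>i\<close> is a time-inhomogeneous Markov chain: conditioning on any history of positive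
  probability, the distribution of the next state is the one-step kernel of the policy.
\<close>

definition markov_run ::
  "('v, 's, 'a, 'i, 'j) model \<Rightarrow> ('v, 's, 'a, 'i) policy \<Rightarrow> 'w measure \<Rightarrow>
   (nat \<Rightarrow> 'v \<Rightarrow> 'w \<Rightarrow> 's) \<Rightarrow> 'i \<Rightarrow> bool" where
  "markov_run m pol M S i \<longleftrightarrow>
     (AE \<omega> in M. run_at m S i 0 \<omega> = joint_init m i) \<and>
     (\<forall>k<horizon m. \<forall>\<sigma>. \<forall>s'\<in>joint_states m i.
        \<P>(\<omega> in M. \<forall>t\<le>k. run_at m S i t \<omega> = \<sigma> t) > 0 \<longrightarrow>
        \<P>(\<omega> in M. run_at m S i (Suc k) \<omega> = s' \<bar> \<forall>t\<le>k. run_at m S i t \<omega> = \<sigma> t) =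
        (\<Sum>a\<in>joint_actions m i. pol i (\<sigma> k) k a * joint_trans m i (\<sigma> k) a s'))"

text \<open>
  Conditionally on the whole run at \<open>i\<close> (that is, under \<open>uniform_measure M E\<close>, which is \<open>M\<close>
  conditioned on the event \<open>E\<close>), the failure variables \<open>R t e\<close> of all pairs \<open>e\<close> at \<open>i\<close> and all
  times \<open>t\<close> are independent, and each has the success probability determined by the states of
  its two agents at time \<open>t\<close>. Conditioning on the whole run rather than on the states at time \<open>t\<close>
  only is what says that failures do not influence the transitions.
\<close>

definition failures_at ::
  "('v, 's, 'a, 'i, 'j) model \<Rightarrow> 'j \<Rightarrow> 'w measure \<Rightarrow>
   (nat \<Rightarrow> 'v \<Rightarrow> 'w \<Rightarrow> 's) \<Rightarrow> (nat \<Rightarrow> 'v uprod \<Rightarrow> 'w \<Rightarrow> bool) \<Rightarrow> 'i \<Rightarrow> bool" where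
  "failures_at m j M S R i \<longleftrightarrow>
     (\<forall>\<sigma>. \<P>(\<omega> in M. \<forall>t\<le>horizon m. run_at m S i t \<omega> = \<sigma> t) > 0 \<longrightarrow>
        prob_space.indep_vars
          (uniform_measure M {\<omega> \<in> space M. \<forall>t\<le>horizon m. run_at m S i t \<omega> = \<sigma> t})
          (\<lambda>_. count_space UNIV) (\<lambda>(t, e). R t e) ({0..horizon m} \<times> pairs m i) \<and>
        (\<forall>t\<le>horizon m. \<forall>e\<in>pairs m i.
           \<P>(\<omega> in M. R t e \<omega> \<bar> \<forall>t\<le>horizon m. run_at m S i t \<omega> = \<sigma> t) = pair_risk m j (\<sigma> t) e))"

text \<open>
  An execution for criterion \<open>j\<close> under policy \<open>pol\<close>: a probability space \<open>M\<close> with the agents'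
  state variables \<open>S t v\<close> and the failure variables \<open>R t e\<close>. The state variables of an agent are
  shared by all interaction points to which it belongs; nothing is prescribed about the joint
  law across different interaction points.
\<close>

definition execution ::
  "('v, 's, 'a, 'i, 'j) model \<Rightarrow> ('v, 's, 'a, 'i) policy \<Rightarrow> 'j \<Rightarrow> 'w measure \<Rightarrow>
   (nat \<Rightarrow> 'v \<Rightarrow> 'w \<Rightarrow> 's) \<Rightarrow> (nat \<Rightarrow> 'v uprod \<Rightarrow> 'w \<Rightarrow> bool) \<Rightarrow> bool" where
  "execution m pol j M S R \<longleftrightarrow>
     prob_space M \<and>
     (\<forall>t\<le>horizon m. \<forall>v\<in>agents m. S t v \<in> measurable M (count_space (states m v))) \<and>
     (\<forall>t\<le>horizon m. \<forall>i\<in>points m. \<forall>e\<in>pairs m i. R t e \<in> measurable M (count_space UNIV)) \<and>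
     (\<forall>i\<in>points m. markov_run m pol M S i \<and> failures_at m j M S R i)"

definition pair_fails ::
  "('v, 's, 'a, 'i, 'j) model \<Rightarrow> (nat \<Rightarrow> 'v uprod \<Rightarrow> 'w \<Rightarrow> bool) \<Rightarrow> 'i \<Rightarrow> 'v uprod \<Rightarrow> 'w \<Rightarrow> bool" where
  "pair_fails m R i e \<omega> \<longleftrightarrow> e \<in> pairs m i \<and> (\<exists>t\<le>horizon m. R t e \<omega>)"

definition point_fails ::
  "('v, 's, 'a, 'i, 'j) model \<Rightarrow> (nat \<Rightarrow> 'v uprod \<Rightarrow> 'w \<Rightarrow> bool) \<Rightarrow> 'i \<Rightarrow> 'w \<Rightarrow> bool" where
  "point_fails m R i \<omega> \<longleftrightarrow> (\<exists>t\<le>horizon m. \<exists>e\<in>pairs m i. R t e \<omega>)"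

text \<open>
  Events are mutually exclusive if they almost surely do not occur together. The first conjunct
  is implied by the second.
\<close>

definition exclusive_failures ::
  "('v, 's, 'a, 'i, 'j) model \<Rightarrow> 'w measure \<Rightarrow> (nat \<Rightarrow> 'v uprod \<Rightarrow> 'w \<Rightarrow> bool) \<Rightarrow> bool" where
  "exclusive_failures m M R \<longleftrightarrow>
     (\<forall>i\<in>points m. \<forall>i'\<in>points m. i \<noteq> i' \<longrightarrow>
        (\<forall>e. AE \<omega> in M. \<not> (pair_fails m R i e \<omega> \<and> pair_fails m R i' e \<omega>)) \<and>
        (AE \<omega> in M. \<not> (point_fails m R i \<omega> \<and> point_fails m R i' \<omega>)))"

definition execution_risk ::
  "('v, 's, 'a, 'i, 'j) model \<Rightarrow> 'w measure \<Rightarrow>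
   (nat \<Rightarrow> 'v \<Rightarrow> 'w \<Rightarrow> 's) \<Rightarrow> (nat \<Rightarrow> 'v uprod \<Rightarrow> 'w \<Rightarrow> bool) \<Rightarrow> real" where
  "execution_risk m M S R =
     \<P>(\<omega> in M. \<exists>t\<le>horizon m. \<exists>i\<in>points m. \<exists>e\<in>pairs m i. R t e \<omega> \<bar>
              \<forall>v\<in>agents m. S 0 v \<omega> = init m v)"

end

theory Submission
  imports Defs
begin

text \<open>
  Fix an interaction point and let \<open>alive k s\<close> be the probability that the run is in \<open>s\<close> at time
  \<open>k\<close> and that no failure happened strictly before \<open>k\<close>. Given the whole run, failures at
  different times are independent, so summing over paths shows that \<open>alive\<close> evolves by the
  kernel of the policy weighted with the survival probability of the state that is left. The flow
  equations are the same recursion, whence \<open>alive k s\<close> is the total plan mass at \<open>(s, k)\<close>; this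
  is also true at \<open>k = horizon m\<close> if the mass is read as the inflow. The first failure happens
  at time \<open>k\<close> with probability \<open>\<Sum>s. alive k s * joint_risk m i j s\<close>, and exclusivity lets
  these probabilities be added over the interaction points.
\<close>

section \<open>Chains whose failures depend only on the current state\<close>

text \<open>\<open>K\<close> is the one-step kernel and \<open>g s\<close> the probability that a
  visit to \<open>s\<close> passes without failure. \<open>survival\<close> conditions on the run up
  to the last time \<open>h\<close> even when \<open>k\<close> is small: this expresses that
  failures do not influence the transitions.\<close>

locale failing_chain = prob_space M for M :: "'w measure" +
  fixes X :: "nat \<Rightarrow> 'w \<Rightarrow> 'b" and F :: "nat \<Rightarrow> 'w \<Rightarrow> bool" and A :: "'b set" and h :: nat
    and s0 :: 'b and K :: "nat \<Rightarrow> 'b \<Rightarrow> 'b \<Rightarrow> real" and g :: "'b \<Rightarrow> real"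
  assumes finite_A: "finite A"
    and X_in: "t \<le> h \<Longrightarrow> \<omega> \<in> space M \<Longrightarrow> X t \<omega> \<in> A"
    and X_pred: "t \<le> h \<Longrightarrow> Measurable.pred M (\<lambda>\<omega>. X t \<omega> = s)"
    and F_pred: "t \<le> h \<Longrightarrow> Measurable.pred M (F t)"
    and X_0: "AE \<omega> in M. X 0 \<omega> = s0"
    and markov: "k < h \<Longrightarrow> s' \<in> A \<Longrightarrow> \<P>(\<omega> in M. \<forall>t\<le>k. X t \<omega> = \<sigma> t) > 0 \<Longrightarrow>
      \<P>(\<omega> in M. X (Suc k) \<omega> = s' \<bar> \<forall>t\<le>k. X t \<omega> = \<sigma> t) = K k (\<sigma> k) s'"
    and survival: "k \<le> Suc h \<Longrightarrow>
      \<P>(\<omega> in M. (\<forall>t\<le>h. X t \<omega> = \<sigma> t) \<and> (\<forall>t<k. \<not> F t \<omega>)) =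
      \<P>(\<omega> in M. \<forall>t\<le>h. X t \<omega> = \<sigma> t) * (\<Prod>t<k. g (\<sigma> t))"
begin

text \<open>The bound \<open>t<k\<close> leaves a failure at time \<open>k\<close> itself open, so
  the survival factor of a state is charged only when the state is left, as in
  \<open>safe_trans\<close>.\<close>

definition alive :: "nat \<Rightarrow> 'b \<Rightarrow> real" where
  "alive k s = \<P>(\<omega> in M. X k \<omega> = s \<and> (\<forall>t<k. \<not> F t \<omega>))"

lemma path_pred: "n \<le> h \<Longrightarrow> Measurable.pred M (\<lambda>\<omega>. \<forall>t\<le>n. X t \<omega> = \<sigma> t)"
proof -
  assume "n \<le> h"
  then have "Measurable.pred M (\<lambda>\<omega>. \<forall>t\<in>{..n}. X t \<omega> = \<sigma> t)"
    by (intro pred_intros_finite X_pred) auto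
  then show ?thesis by (simp only: Ball_def atMost_iff)
qed

lemma no_failure_pred: "k \<le> Suc h \<Longrightarrow> Measurable.pred M (\<lambda>\<omega>. \<forall>t<k. \<not> F t \<omega>)"
proof -
  assume "k \<le> Suc h"
  then have "Measurable.pred M (\<lambda>\<omega>. \<forall>t\<in>{..<k}. \<not> F t \<omega>)"
    by (intro pred_intros_finite pred_intros_logic F_pred) auto
  then show ?thesis by (simp only: Ball_def lessThan_iff)
qed

lemma alive_0: "alive 0 s = (if s = s0 then 1 else 0)"
proof (cases "s = s0")
  case True
  then have "AE \<omega> in M. X 0 \<omega> = s" using X_0 by simp
  then show ?thesis
    using True prob_Collect_eq_1[OF X_pred[of 0 s, unfolded pred_def]] by (simp add: alive_def)
next
  case False
  then have "AE \<omega> in M. \<not> X 0 \<omega> = s" using X_0 by (auto elim: eventually_mono)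
  then show ?thesis
    using False prob_Collect_eq_0[OF X_pred[of 0 s, unfolded pred_def]] by (simp add: alive_def)
qed

text \<open>The events of following the various paths partition the space, and there are finitely
  many of them because \<open>A\<close> is finite.\<close>

lemma sum_over_paths:
  assumes "n \<le> h" and Q: "Measurable.pred M Q"
  shows "\<P>(\<omega> in M. Q \<omega>) =
    (\<Sum>\<sigma>\<in>{..n} \<rightarrow>\<^sub>E A. \<P>(\<omega> in M. Q \<omega> \<and> (\<forall>t\<le>n. X t \<omega> = \<sigma> t)))"
proof (rule prob_sum)
  show "finite ({..n} \<rightarrow>\<^sub>E A)" by (simp add: finite_PiE finite_A)
  show "{\<omega> \<in> space M. Q \<omega> \<and> (\<forall>t\<le>n. X t \<omega> = \<sigma> t)} \<in> events" for \<sigma>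
    using pred_intros_logic(3)[OF Q path_pred[OF \<open>n \<le> h\<close>]] by (simp add: pred_def)
  show "{\<omega> \<in> space M. Q \<omega>} \<in> events" using Q by (simp add: pred_def)
  \<comment> \<open>The witness is the trajectory of \<omega> cut off after \<open>n\<close>;
    uniqueness holds because members of the extensional function space are \<open>undefined\<close>
    at later times.\<close>
  have "\<exists>!\<sigma>. \<sigma> \<in> {..n} \<rightarrow>\<^sub>E A \<and> (\<forall>t\<le>n. X t \<omega> = \<sigma> t)" if "\<omega> \<in> space M" for \<omega>
  proof (rule ex1I[of _ "restrict (\<lambda>t. X t \<omega>) {..n}"])
    show "restrict (\<lambda>t. X t \<omega>) {..n} \<in> {..n} \<rightarrow>\<^sub>E A \<and>
        (\<forall>t\<le>n. X t \<omega> = restrict (\<lambda>t. X t \<omega>) {..n} t)"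
      using X_in that \<open>n \<le> h\<close> by auto
  next
    fix \<sigma> assume "\<sigma> \<in> {..n} \<rightarrow>\<^sub>E A \<and> (\<forall>t\<le>n. X t \<omega> = \<sigma> t)"
    then show "\<sigma> = restrict (\<lambda>t. X t \<omega>) {..n}"
      by (intro ext) (auto simp: restrict_def PiE_def extensional_def)
  qed
  then show "AE \<omega> in M. (\<forall>\<sigma>\<in>{..n} \<rightarrow>\<^sub>E A. Q \<omega> \<and> (\<forall>t\<le>n. X t \<omega> = \<sigma> t) \<longrightarrow> Q \<omega>) \<and>
      (Q \<omega> \<longrightarrow> (\<exists>!\<sigma>. \<sigma> \<in> {..n} \<rightarrow>\<^sub>E A \<and> Q \<omega> \<and> (\<forall>t\<le>n. X t \<omega> = \<sigma> t)))"
    by (intro AE_I2) auto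
qed

text \<open>Passes from full runs to prefixes. The induction goes down from \<open>h\<close>, where
  \<open>survival\<close> applies: a prefix is the disjoint union of its one-step extensions, and
  the product, involving only times below \<open>k \<le> Suc n\<close>, is the same for all of
  them.\<close>

lemma path_survival:
  assumes "n \<le> h" "k \<le> Suc n"
  shows "\<P>(\<omega> in M. (\<forall>t\<le>n. X t \<omega> = \<sigma> t) \<and> (\<forall>t<k. \<not> F t \<omega>)) =
    \<P>(\<omega> in M. \<forall>t\<le>n. X t \<omega> = \<sigma> t) * (\<Prod>t<k. g (\<sigma> t))"
  using assms
proof (induction arbitrary: \<sigma> rule: inc_induct)
  case base
  then show ?case by (simp add: survival)
next
  case (step n)
  have extend: "(\<forall>t\<le>n. X t \<omega> = \<sigma> t) \<and> X (Suc n) \<omega> = s \<longleftrightarrow>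
      (\<forall>t\<le>Suc n. X t \<omega> = (\<sigma>(Suc n := s)) t)" for \<omega> s
    by (auto simp: le_Suc_eq)
  \<comment> \<open>Stated for any \<open>Q\<close>: it is used with survival before
    \<open>k\<close> and, at the end, with \<open>True\<close> to reassemble the bare
    prefix.\<close>
  have split: "\<P>(\<omega> in M. (\<forall>t\<le>n. X t \<omega> = \<sigma> t) \<and> Q \<omega>) =
      (\<Sum>s\<in>A. \<P>(\<omega> in M. (\<forall>t\<le>Suc n. X t \<omega> = (\<sigma>(Suc n := s)) t) \<and> Q \<omega>))"
    if Q: "Measurable.pred M Q" for Q
  proof (rule prob_sum[OF finite_A])
    show "{\<omega> \<in> space M. (\<forall>t\<le>Suc n. X t \<omega> = (\<sigma>(Suc n := s)) t) \<and> Q \<omega>} \<in> events" for s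
      using pred_intros_logic(3)[OF path_pred[OF Suc_leI[OF step(2)], of "\<sigma>(Suc n := s)"] Q]
      by (simp only: pred_def)
    show "{\<omega> \<in> space M. (\<forall>t\<le>n. X t \<omega> = \<sigma> t) \<and> Q \<omega>} \<in> events"
      using pred_intros_logic(3)[OF path_pred[OF less_imp_le[OF step(2)], of \<sigma>] Q]
      by (simp only: pred_def)
    show "AE \<omega> in M.
      (\<forall>s\<in>A. (\<forall>t\<le>Suc n. X t \<omega> = (\<sigma>(Suc n := s)) t) \<and> Q \<omega> \<longrightarrow> (\<forall>t\<le>n. X t \<omega> = \<sigma> t) \<and> Q \<omega>) \<and>
      ((\<forall>t\<le>n. X t \<omega> = \<sigma> t) \<and> Q \<omega> \<longrightarrow>
        (\<exists>!s. s \<in> A \<and> (\<forall>t\<le>Suc n. X t \<omega> = (\<sigma>(Suc n := s)) t) \<and> Q \<omega>))"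
    proof (rule AE_I2)
      fix \<omega> assume "\<omega> \<in> space M"
      then have "X (Suc n) \<omega> \<in> A" using X_in step(2) by simp
      then show "(\<forall>s\<in>A. (\<forall>t\<le>Suc n. X t \<omega> = (\<sigma>(Suc n := s)) t) \<and> Q \<omega> \<longrightarrow>
            (\<forall>t\<le>n. X t \<omega> = \<sigma> t) \<and> Q \<omega>) \<and>
          ((\<forall>t\<le>n. X t \<omega> = \<sigma> t) \<and> Q \<omega> \<longrightarrow>
            (\<exists>!s. s \<in> A \<and> (\<forall>t\<le>Suc n. X t \<omega> = (\<sigma>(Suc n := s)) t) \<and> Q \<omega>))"
        unfolding extend[symmetric] by (intro conjI ballI impI ex1I[of _ "X (Suc n) \<omega>"]) simp_all
    qed
  qed
  have "\<P>(\<omega> in M. (\<forall>t\<le>n. X t \<omega> = \<sigma> t) \<and> (\<forall>t<k. \<not> F t \<omega>)) =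
      (\<Sum>s\<in>A. \<P>(\<omega> in M. (\<forall>t\<le>Suc n. X t \<omega> = (\<sigma>(Suc n := s)) t) \<and> (\<forall>t<k. \<not> F t \<omega>)))"
    using step(2) step.prems by (intro split[OF no_failure_pred]) linarith
  also have "\<dots> = (\<Sum>s\<in>A. \<P>(\<omega> in M. \<forall>t\<le>Suc n. X t \<omega> = (\<sigma>(Suc n := s)) t) *
      (\<Prod>t<k. g ((\<sigma>(Suc n := s)) t)))"
    using step.prems by (intro sum.cong refl step.IH) linarith
  also have "\<dots> = (\<Sum>s\<in>A. \<P>(\<omega> in M. \<forall>t\<le>Suc n. X t \<omega> = (\<sigma>(Suc n := s)) t) *
      (\<Prod>t<k. g (\<sigma> t)))"
    using step.prems
    by (intro sum.cong refl arg_cong2[where f = "(*)"] prod.cong) auto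
  also have "\<dots> = (\<Sum>s\<in>A. \<P>(\<omega> in M. \<forall>t\<le>Suc n. X t \<omega> = (\<sigma>(Suc n := s)) t)) *
      (\<Prod>t<k. g (\<sigma> t))"
    by (simp only: sum_distrib_right)
  also have "(\<Sum>s\<in>A. \<P>(\<omega> in M. \<forall>t\<le>Suc n. X t \<omega> = (\<sigma>(Suc n := s)) t)) =
      \<P>(\<omega> in M. \<forall>t\<le>n. X t \<omega> = \<sigma> t)"
    using split[of "\<lambda>_. True"] by simp
  finally show ?case .
qed

text \<open>The Markov property multiplied out. In this form no positivity is required: on a null
  history both sides are 0.\<close>

lemma path_Suc:
  assumes "k < h" "s' \<in> A"
  shows "\<P>(\<omega> in M. (\<forall>t\<le>k. X t \<omega> = \<sigma> t) \<and> X (Suc k) \<omega> = s') =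
    \<P>(\<omega> in M. \<forall>t\<le>k. X t \<omega> = \<sigma> t) * K k (\<sigma> k) s'"
proof (cases "\<P>(\<omega> in M. \<forall>t\<le>k. X t \<omega> = \<sigma> t) = 0")
  case True
  have "\<P>(\<omega> in M. (\<forall>t\<le>k. X t \<omega> = \<sigma> t) \<and> X (Suc k) \<omega> = s') \<le> \<P>(\<omega> in M. \<forall>t\<le>k. X t \<omega> = \<sigma> t)"
    using path_pred[OF less_imp_le[OF assms(1)], of \<sigma>]
    by (intro finite_measure_mono) (auto simp only: pred_def)
  then show ?thesis using True by (simp add: measure_le_0_iff)
next
  case False
  then have "\<P>(\<omega> in M. \<forall>t\<le>k. X t \<omega> = \<sigma> t) > 0" by (simp add: zero_less_measure_iff)
  from markov[OF assms this] False show ?thesis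
    by (simp add: cond_prob_def field_simps conj_commute)
qed

text \<open>Paths are grouped by their last state, on which alone the weight \<phi> depends. The
  weights used later are 1, \<open>g\<close>, and \<open>g\<close> times the kernel.\<close>

lemma sum_paths_alive:
  assumes "k \<le> h"
  shows "(\<Sum>\<sigma>\<in>{..k} \<rightarrow>\<^sub>E A.
      \<P>(\<omega> in M. (\<forall>t\<le>k. X t \<omega> = \<sigma> t) \<and> (\<forall>t<k. \<not> F t \<omega>)) * \<phi> (\<sigma> k)) =
    (\<Sum>s\<in>A. alive k s * \<phi> s)"
proof -
  let ?P = "\<lambda>\<sigma>. \<P>(\<omega> in M. (\<forall>t\<le>k. X t \<omega> = \<sigma> t) \<and> (\<forall>t<k. \<not> F t \<omega>))"
  have fin: "finite ({..k} \<rightarrow>\<^sub>E A)" by (simp add: finite_PiE finite_A)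
  have alive: "alive k s = (\<Sum>\<sigma>\<in>{\<sigma> \<in> {..k} \<rightarrow>\<^sub>E A. \<sigma> k = s}. ?P \<sigma>)" for s
  proof -
    have "alive k s = (\<Sum>\<sigma>\<in>{..k} \<rightarrow>\<^sub>E A.
        \<P>(\<omega> in M. (X k \<omega> = s \<and> (\<forall>t<k. \<not> F t \<omega>)) \<and> (\<forall>t\<le>k. X t \<omega> = \<sigma> t)))"
      unfolding alive_def using assms
      by (intro sum_over_paths pred_intros_logic(3) X_pred no_failure_pred) auto
    \<comment> \<open>A path that does not end in \<open>s\<close> yields the empty event, hence the
      0.\<close>
    also have "\<dots> = (\<Sum>\<sigma>\<in>{..k} \<rightarrow>\<^sub>E A. if \<sigma> k = s then ?P \<sigma> else 0)"
    proof (intro sum.cong refl)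
      fix \<sigma>
      have "{\<omega> \<in> space M. (X k \<omega> = s \<and> (\<forall>t<k. \<not> F t \<omega>)) \<and> (\<forall>t\<le>k. X t \<omega> = \<sigma> t)} =
         (if \<sigma> k = s then {\<omega> \<in> space M. (\<forall>t\<le>k. X t \<omega> = \<sigma> t) \<and> (\<forall>t<k. \<not> F t \<omega>)} else {})"
        by auto
      then show "\<P>(\<omega> in M. (X k \<omega> = s \<and> (\<forall>t<k. \<not> F t \<omega>)) \<and> (\<forall>t\<le>k. X t \<omega> = \<sigma> t)) =
         (if \<sigma> k = s then ?P \<sigma> else 0)"
        by simp
    qed
    also have "\<dots> = (\<Sum>\<sigma>\<in>{\<sigma> \<in> {..k} \<rightarrow>\<^sub>E A. \<sigma> k = s}. ?P \<sigma>)"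
      using fin by (simp add: sum.inter_filter)
    finally show ?thesis .
  qed
  have "(\<Sum>\<sigma>\<in>{..k} \<rightarrow>\<^sub>E A. ?P \<sigma> * \<phi> (\<sigma> k)) =
      (\<Sum>s\<in>A. \<Sum>\<sigma>\<in>{\<sigma> \<in> {..k} \<rightarrow>\<^sub>E A. \<sigma> k = s}. ?P \<sigma> * \<phi> (\<sigma> k))"
    by (rule sum.group[symmetric]) (use fin finite_A in auto)
  then show ?thesis by (simp add: alive sum_distrib_right)
qed

text \<open>On each path, surviving time \<open>k\<close> as well costs the factor
  \<open>g (\<sigma> k)\<close>, and the next transition costs \<open>K k (\<sigma> k) s'\<close>.
  Both depend only on the last state of the path, so grouping by that state gives the
  recursion.\<close>

lemma alive_Suc:
  assumes "k < h" "s' \<in> A"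
  shows "alive (Suc k) s' = (\<Sum>s\<in>A. alive k s * (g s * K k s s'))"
proof -
  have "alive (Suc k) s' = (\<Sum>\<sigma>\<in>{..k} \<rightarrow>\<^sub>E A.
      \<P>(\<omega> in M. (X (Suc k) \<omega> = s' \<and> (\<forall>t<Suc k. \<not> F t \<omega>)) \<and> (\<forall>t\<le>k. X t \<omega> = \<sigma> t)))"
    unfolding alive_def using assms
    by (intro sum_over_paths pred_intros_logic(3) X_pred no_failure_pred) auto
  also have "\<dots> = (\<Sum>\<sigma>\<in>{..k} \<rightarrow>\<^sub>E A.
      \<P>(\<omega> in M. (\<forall>t\<le>k. X t \<omega> = \<sigma> t) \<and> (\<forall>t<k. \<not> F t \<omega>)) * (g (\<sigma> k) * K k (\<sigma> k) s'))"
  proof (intro sum.cong refl)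
    fix \<sigma> :: "nat \<Rightarrow> 'b"
    let ?\<sigma> = "\<sigma>(Suc k := s')"
    have path: "(\<forall>t\<le>Suc k. X t \<omega> = ?\<sigma> t) \<longleftrightarrow> (\<forall>t\<le>k. X t \<omega> = \<sigma> t) \<and> X (Suc k) \<omega> = s'" for \<omega>
      by (auto simp: le_Suc_eq)
    have "\<P>(\<omega> in M. (X (Suc k) \<omega> = s' \<and> (\<forall>t<Suc k. \<not> F t \<omega>)) \<and> (\<forall>t\<le>k. X t \<omega> = \<sigma> t)) =
        \<P>(\<omega> in M. (\<forall>t\<le>Suc k. X t \<omega> = ?\<sigma> t) \<and> (\<forall>t<Suc k. \<not> F t \<omega>))"
      unfolding path by (rule arg_cong[where f = prob]) blast
    \<comment> \<open>The product stops at time \<open>k\<close>, so the state \<open>s'\<close>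
      adjoined at \<open>Suc k\<close> carries no factor yet.\<close>
    also have "\<dots> = \<P>(\<omega> in M. \<forall>t\<le>Suc k. X t \<omega> = ?\<sigma> t) * (\<Prod>t<Suc k. g (?\<sigma> t))"
      using assms by (intro path_survival) auto
    also have "\<dots> = \<P>(\<omega> in M. \<forall>t\<le>k. X t \<omega> = \<sigma> t) * K k (\<sigma> k) s' * (\<Prod>t<Suc k. g (\<sigma> t))"
      unfolding path path_Suc[OF assms] by simp
    also have "\<dots> = (\<P>(\<omega> in M. \<forall>t\<le>k. X t \<omega> = \<sigma> t) * (\<Prod>t<k. g (\<sigma> t))) * (g (\<sigma> k) * K k (\<sigma> k) s')"
      by (simp add: mult_ac)
    also have "\<P>(\<omega> in M. \<forall>t\<le>k. X t \<omega> = \<sigma> t) * (\<Prod>t<k. g (\<sigma> t)) =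
        \<P>(\<omega> in M. (\<forall>t\<le>k. X t \<omega> = \<sigma> t) \<and> (\<forall>t<k. \<not> F t \<omega>))"
      using assms by (intro path_survival[symmetric]) auto
    finally show "\<P>(\<omega> in M. (X (Suc k) \<omega> = s' \<and> (\<forall>t<Suc k. \<not> F t \<omega>)) \<and> (\<forall>t\<le>k. X t \<omega> = \<sigma> t)) =
        \<P>(\<omega> in M. (\<forall>t\<le>k. X t \<omega> = \<sigma> t) \<and> (\<forall>t<k. \<not> F t \<omega>)) * (g (\<sigma> k) * K k (\<sigma> k) s')" .
  qed
  also have "\<dots> = (\<Sum>s\<in>A. alive k s * (g s * K k s s'))"
    using assms by (intro sum_paths_alive[of k "\<lambda>s. g s * K k s s'"]) auto
  finally show ?thesis .
qed

lemma prob_no_failure_before: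
  assumes "k \<le> h"
  shows "\<P>(\<omega> in M. \<forall>t<k. \<not> F t \<omega>) = (\<Sum>s\<in>A. alive k s)"
proof -
  have "\<P>(\<omega> in M. \<forall>t<k. \<not> F t \<omega>) =
      (\<Sum>\<sigma>\<in>{..k} \<rightarrow>\<^sub>E A. \<P>(\<omega> in M. (\<forall>t<k. \<not> F t \<omega>) \<and> (\<forall>t\<le>k. X t \<omega> = \<sigma> t)))"
    using assms by (intro sum_over_paths no_failure_pred) auto
  then show ?thesis
    using sum_paths_alive[OF assms, of "\<lambda>_. 1"] by (simp add: conj_commute)
qed

text \<open>Summing over the states at time \<open>k\<close> rather than \<open>Suc k\<close>
  includes the case \<open>k = h\<close>, after which no further state is described.\<close>

lemma prob_no_failure_upto:
  assumes "k \<le> h"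
  shows "\<P>(\<omega> in M. \<forall>t<Suc k. \<not> F t \<omega>) = (\<Sum>s\<in>A. alive k s * g s)"
proof -
  have "\<P>(\<omega> in M. \<forall>t<Suc k. \<not> F t \<omega>) =
      (\<Sum>\<sigma>\<in>{..k} \<rightarrow>\<^sub>E A. \<P>(\<omega> in M. (\<forall>t<Suc k. \<not> F t \<omega>) \<and> (\<forall>t\<le>k. X t \<omega> = \<sigma> t)))"
    using assms by (intro sum_over_paths no_failure_pred) auto
  also have "\<dots> = (\<Sum>\<sigma>\<in>{..k} \<rightarrow>\<^sub>E A.
      \<P>(\<omega> in M. (\<forall>t\<le>k. X t \<omega> = \<sigma> t) \<and> (\<forall>t<k. \<not> F t \<omega>)) * g (\<sigma> k))"
    \<comment> \<open>The two instances differ exactly by the factor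
      \<open>g (\<sigma> k)\<close>.\<close>
    using assms path_survival[OF assms, of k] path_survival[OF assms, of "Suc k"]
    by (simp add: conj_commute mult.assoc)
  finally show ?thesis by (simp add: sum_paths_alive[OF assms])
qed

text \<open>The probability of survival falls from 1 to its final value in \<open>Suc h\<close>
  steps, and the drop in step \<open>k\<close> is the probability that the first failure happens at
  time \<open>k\<close>.\<close>

lemma prob_failure:
  "\<P>(\<omega> in M. \<exists>t\<le>h. F t \<omega>) = (\<Sum>k\<le>h. \<Sum>s\<in>A. alive k s * (1 - g s))"
proof -
  let ?N = "\<lambda>k. \<P>(\<omega> in M. \<forall>t<k. \<not> F t \<omega>)"
  have "\<P>(\<omega> in M. \<not> (\<forall>t<Suc h. \<not> F t \<omega>)) = 1 - ?N (Suc h)"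
    using no_failure_pred[OF order.refl] by (intro prob_neg) (simp only: pred_def)
  \<comment> \<open>No time lies before 0, so \<open>?N 0 = 1\<close>; this supplies the upper end
    of the telescope.\<close>
  also have "\<dots> = ?N 0 - ?N (Suc h)"
    by (simp add: prob_space)
  also have "\<dots> = (\<Sum>k<Suc h. ?N k - ?N (Suc k))"
    by (rule sum_lessThan_telescope'[symmetric])
  also have "\<dots> = (\<Sum>k\<le>h. \<Sum>s\<in>A. alive k s * (1 - g s))"
    unfolding lessThan_Suc_atMost
    by (intro sum.cong refl, subst prob_no_failure_before, simp, subst prob_no_failure_upto, simp)
       (simp add: sum_subtractf algebra_simps)
  finally show ?thesis by (simp add: less_Suc_eq_le)
qed

end

section \<open>Finiteness at one interaction point\<close>

lemma finite_pairs:
  assumes "finite (members m i)"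
  shows "finite (pairs m i)"
proof (rule finite_subset)
  show "pairs m i \<subseteq> (\<lambda>(v, v'). Upair v v') ` (members m i \<times> members m i)"
  proof
    fix e assume "e \<in> pairs m i"
    then show "e \<in> (\<lambda>(v, v'). Upair v v') ` (members m i \<times> members m i)"
      by (cases e) (auto simp: pairs_def)
  qed
qed (use assms in simp)

context
  fixes m :: "('v, 's, 'a, 'i, 'j::zero) model" and i :: 'i
  assumes m: "valid_model m" and i: "i \<in> points m"
begin

lemma members_subset: "members m i \<subseteq> agents m"
  using m i by (auto simp: valid_model_def)

lemma finite_members: "finite (members m i)"
  using m members_subset by (auto simp: valid_model_def intro: finite_subset)

lemma finite_joint_states: "finite (joint_states m i)"
  using m members_subset finite_members
  unfolding joint_states_def valid_model_def by (intro finite_PiE) auto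

lemma finite_joint_actions: "finite (joint_actions m i)"
  using m members_subset finite_members
  unfolding joint_actions_def valid_model_def by (intro finite_PiE) auto

lemma joint_init_in: "joint_init m i \<in> joint_states m i"
  using m members_subset by (auto simp: joint_init_def joint_states_def valid_model_def)

end

section \<open>Executions as failing chains\<close>

lemma (in prob_space) prob_none_of_indep:
  fixes B :: "'k \<Rightarrow> 'a \<Rightarrow> bool"
  assumes indep: "indep_vars (\<lambda>_. count_space UNIV) B I" and J: "finite J" "J \<subseteq> I"
  shows "\<P>(\<omega> in M. \<forall>b\<in>J. \<not> B b \<omega>) = (\<Prod>b\<in>J. 1 - \<P>(\<omega> in M. B b \<omega>))"
\<comment> \<open>The empty index set is separate: an intersection over it would be
  \<open>UNIV\<close> instead of \<open>space M\<close>.\<close>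
proof (cases "J = {}")
  case True
  then show ?thesis by (simp add: prob_space)
next
  case False
  have "{\<omega> \<in> space M. \<forall>b\<in>J. \<not> B b \<omega>} = (\<Inter>b\<in>J. B b -` {False} \<inter> space M)"
    using False by auto
  also have "prob \<dots> = (\<Prod>b\<in>J. prob (B b -` {False} \<inter> space M))"
    using False J by (intro indep_varsD[OF indep]) auto
  also have "\<dots> = (\<Prod>b\<in>J. 1 - \<P>(\<omega> in M. B b \<omega>))"
  proof (intro prod.cong refl)
    fix b assume "b \<in> J"
    then have "random_variable (count_space UNIV) (B b)"
      using indep J by (auto simp: indep_vars_def)
    then have "\<P>(\<omega> in M. \<not> B b \<omega>) = 1 - \<P>(\<omega> in M. B b \<omega>)"
      by (intro prob_neg) (simp only: pred_def)
    moreover have "B b -` {False} \<inter> space M = {\<omega> \<in> space M. \<not> B b \<omega>}" by auto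
    ultimately show "prob (B b -` {False} \<inter> space M) = 1 - \<P>(\<omega> in M. B b \<omega>)" by simp
  qed
  finally show ?thesis .
qed

text \<open>Moves the run and the failures at one point into the abstract setting. The main work is
  the survival law: given the whole run, the failure variables of all times and pairs are
  independent, so their survival probabilities multiply.\<close>

lemma execution_failing_chain:
  assumes m: "valid_model m" and i: "i \<in> points m" and ex: "execution m pol j M S R"
  shows "failing_chain M (run_at m S i) (\<lambda>t \<omega>. \<exists>e\<in>pairs m i. R t e \<omega>) (joint_states m i)
    (horizon m) (joint_init m i)
    (\<lambda>k s s'. \<Sum>a\<in>joint_actions m i. pol i s k a * joint_trans m i s a s')
    (\<lambda>s. \<Prod>e\<in>pairs m i. 1 - pair_risk m j s e)"
proof -
  interpret prob_space M using ex by (simp add: execution_def)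
  let ?h = "horizon m" and ?X = "run_at m S i"
  have S_meas: "S t v \<in> M \<rightarrow>\<^sub>M count_space (states m v)" if "t \<le> ?h" "v \<in> members m i" for t v
    using ex that members_subset[OF m i] by (auto simp: execution_def)
  have R_meas: "Measurable.pred M (R t e)" if "t \<le> ?h" "e \<in> pairs m i" for t e
    using ex that i by (auto simp: execution_def)
  have mk: "markov_run m pol M S i" and fl: "failures_at m j M S R i"
    using ex i by (auto simp: execution_def)
  note fin_pairs = finite_pairs[OF finite_members[OF m i]]
  have X_in: "?X t \<omega> \<in> joint_states m i" if "t \<le> ?h" "\<omega> \<in> space M" for t \<omega>
    using measurable_space[OF S_meas[OF that(1)] that(2)]
    by (auto simp: run_at_def joint_states_def)
  have X_pred: "Measurable.pred M (\<lambda>\<omega>. ?X t \<omega> = s)" if "t \<le> ?h" for t s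
  proof (cases "s \<in> extensional (members m i)")
    case True
    then have "(?X t \<omega> = s) \<longleftrightarrow> (\<forall>v\<in>members m i. S t v \<omega> = s v)" for \<omega>
      by (auto simp: run_at_def extensional_def fun_eq_iff restrict_def)
    moreover have "Measurable.pred M (\<lambda>\<omega>. S t v \<omega> = s v)" if "v \<in> members m i" for v
      by (rule pred_eq_const1[OF S_meas[OF \<open>t \<le> ?h\<close> that]])
        (cases "s v \<in> states m v"; simp)
    ultimately show ?thesis
      by (simp only:) (intro pred_intros_finite finite_members[OF m i])
  next
    case False
    \<comment> \<open>A run is extensional on \<open>members m i\<close> and therefore never equals
      such an \<open>s\<close>.\<close>
    then have "(?X t \<omega> = s) \<longleftrightarrow> False" for \<omega>
      by (auto simp: run_at_def)
    then show ?thesis by simp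
  qed
  have path_pred: "Measurable.pred M (\<lambda>\<omega>. \<forall>t\<le>?h. ?X t \<omega> = \<sigma> t)" for \<sigma>
  proof -
    have "Measurable.pred M (\<lambda>\<omega>. \<forall>t\<in>{..?h}. ?X t \<omega> = \<sigma> t)"
      by (intro pred_intros_finite X_pred) auto
    then show ?thesis by (simp only: Ball_def atMost_iff)
  qed
  have surv: "\<P>(\<omega> in M. (\<forall>t\<le>?h. ?X t \<omega> = \<sigma> t) \<and> (\<forall>t<k. \<not> (\<exists>e\<in>pairs m i. R t e \<omega>))) =
      \<P>(\<omega> in M. \<forall>t\<le>?h. ?X t \<omega> = \<sigma> t) * (\<Prod>t<k. \<Prod>e\<in>pairs m i. 1 - pair_risk m j (\<sigma> t) e)"
    if k: "k \<le> Suc ?h" for k \<sigma>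
  \<comment> \<open>\<open>failures_at\<close> is silent about null runs; for these both sides
    vanish.\<close>
  proof (cases "\<P>(\<omega> in M. \<forall>t\<le>?h. ?X t \<omega> = \<sigma> t) = 0")
    case True
    have "\<P>(\<omega> in M. (\<forall>t\<le>?h. ?X t \<omega> = \<sigma> t) \<and> (\<forall>t<k. \<not> (\<exists>e\<in>pairs m i. R t e \<omega>))) \<le>
        \<P>(\<omega> in M. \<forall>t\<le>?h. ?X t \<omega> = \<sigma> t)"
      using path_pred[of \<sigma>] by (intro finite_measure_mono) (auto simp only: pred_def)
    then show ?thesis using True by (simp add: measure_le_0_iff)
  next
    case False
    then have pos: "\<P>(\<omega> in M. \<forall>t\<le>?h. ?X t \<omega> = \<sigma> t) > 0" by (simp add: zero_less_measure_iff)
    define U where "U = uniform_measure M {\<omega> \<in> space M. \<forall>t\<le>?h. ?X t \<omega> = \<sigma> t}"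
    \<comment> \<open>Indices of the failure variables before \<open>k\<close>;
      \<open>k \<le> Suc ?h\<close> keeps their times within the horizon.\<close>
    let ?J = "{..<k} \<times> pairs m i"
    have indep: "prob_space.indep_vars U (\<lambda>_. count_space UNIV) (\<lambda>(t, e). R t e)
        ({0..?h} \<times> pairs m i)"
      and risk: "\<And>t e. t \<le> ?h \<Longrightarrow> e \<in> pairs m i \<Longrightarrow>
        \<P>(\<omega> in M. R t e \<omega> \<bar> \<forall>t\<le>?h. ?X t \<omega> = \<sigma> t) = pair_risk m j (\<sigma> t) e"
      using fl pos unfolding failures_at_def U_def by blast+
    have U: "prob_space U"
      unfolding U_def using pos by (intro prob_space_uniform_measure) (auto simp: emeasure_eq_measure)
    \<comment> \<open>Links the measure \<open>U\<close>, under which independence is given, with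
      the conditional probabilities, in which the failure rates are given.\<close>
    have U_cond: "\<P>(\<omega> in U. Q \<omega>) = \<P>(\<omega> in M. Q \<omega> \<bar> \<forall>t\<le>?h. ?X t \<omega> = \<sigma> t)"
      if "Measurable.pred M Q" for Q
      unfolding U_def space_uniform_measure
      using measure_uniform_measure_eq_cond_prob[OF that path_pred[of \<sigma>]] by simp
    have J: "finite ?J" "?J \<subseteq> {0..?h} \<times> pairs m i"
      using fin_pairs k by auto
    have "\<P>(\<omega> in M. (\<forall>b\<in>?J. \<not> (case b of (t, e) \<Rightarrow> R t e) \<omega>) \<bar> \<forall>t\<le>?h. ?X t \<omega> = \<sigma> t) =
        \<P>(\<omega> in U. \<forall>b\<in>?J. \<not> (case b of (t, e) \<Rightarrow> R t e) \<omega>)"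
    proof (rule U_cond[symmetric])
      show "Measurable.pred M (\<lambda>\<omega>. \<forall>b\<in>?J. \<not> (case b of (t, e) \<Rightarrow> R t e) \<omega>)"
        by (intro pred_intros_finite pred_intros_logic J) (use R_meas k in auto)
    qed
    also have "\<dots> = (\<Prod>b\<in>?J. 1 - \<P>(\<omega> in U. (case b of (t, e) \<Rightarrow> R t e) \<omega>))"
      by (rule prob_space.prob_none_of_indep[OF U indep J])
    also have "\<dots> = (\<Prod>(t, e)\<in>?J. 1 - pair_risk m j (\<sigma> t) e)"
    proof (intro prod.cong refl)
      fix b assume "b \<in> ?J"
      then obtain t e where b: "b = (t, e)" "t \<le> ?h" "e \<in> pairs m i" using k by auto
      then show "1 - \<P>(\<omega> in U. (case b of (t, e) \<Rightarrow> R t e) \<omega>) =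
          (case b of (t, e) \<Rightarrow> 1 - pair_risk m j (\<sigma> t) e)"
        by (simp only: prod.case U_cond[OF R_meas] risk)
    qed
    also have "\<dots> = (\<Prod>t<k. \<Prod>e\<in>pairs m i. 1 - pair_risk m j (\<sigma> t) e)"
      by (simp add: prod.cartesian_product)
    finally have "\<P>(\<omega> in M. (\<forall>b\<in>?J. \<not> (case b of (t, e) \<Rightarrow> R t e) \<omega>) \<and> (\<forall>t\<le>?h. ?X t \<omega> = \<sigma> t)) =
        \<P>(\<omega> in M. \<forall>t\<le>?h. ?X t \<omega> = \<sigma> t) * (\<Prod>t<k. \<Prod>e\<in>pairs m i. 1 - pair_risk m j (\<sigma> t) e)"
      using False by (simp add: cond_prob_def field_simps)
    moreover have "(\<forall>b\<in>?J. \<not> (case b of (t, e) \<Rightarrow> R t e) \<omega>) \<and> (\<forall>t\<le>?h. ?X t \<omega> = \<sigma> t) \<longleftrightarrow>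
        (\<forall>t\<le>?h. ?X t \<omega> = \<sigma> t) \<and> (\<forall>t<k. \<not> (\<exists>e\<in>pairs m i. R t e \<omega>))" for \<omega>
      by auto
    ultimately show ?thesis by (simp only:)
  qed
  show ?thesis
  proof unfold_locales
    show "finite (joint_states m i)" by (rule finite_joint_states[OF m i])
    show "AE \<omega> in M. ?X 0 \<omega> = joint_init m i" using mk by (simp add: markov_run_def)
    show "Measurable.pred M (\<lambda>\<omega>. \<exists>e\<in>pairs m i. R t e \<omega>)" if "t \<le> ?h" for t
      by (intro pred_intros_finite fin_pairs R_meas that)
    show "\<P>(\<omega> in M. ?X (Suc k) \<omega> = s' \<bar> \<forall>t\<le>k. ?X t \<omega> = \<sigma> t) =
        (\<Sum>a\<in>joint_actions m i. pol i (\<sigma> k) k a * joint_trans m i (\<sigma> k) a s')"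
      if "k < ?h" "s' \<in> joint_states m i" "\<P>(\<omega> in M. \<forall>t\<le>k. ?X t \<omega> = \<sigma> t) > 0" for k s' \<sigma>
      using mk that unfolding markov_run_def by blast
  qed (fact X_in X_pred surv)+
qed

section \<open>Plan mass as survival probability\<close>

text \<open>Where the denominator of the policy is 0, nonnegativity forces every plan entry to be 0,
  so the arbitrary choice of \<open>pol\<close> there does no harm.\<close>

lemma plan_eq_policy_mult:
  assumes m: "valid_model m" and plan: "conditional_plan m x" and j: "j \<in> criteria m"
    and pol: "policy_given_by m x j pol" and i: "i \<in> points m"
    and s: "s \<in> joint_states m i" and k: "k < horizon m" and a: "a \<in> joint_actions m i"
  shows "x i j s k a = pol i s k a * (\<Sum>a\<in>joint_actions m i. x i j s k a)"
proof (cases "(\<Sum>a\<in>joint_actions m i. x i j s k a) = 0")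
  case True
  moreover have "\<forall>a\<in>joint_actions m i. x i j s k a \<ge> 0"
    using plan i j s k unfolding conditional_plan_def by (meson UnI1 atLeastAtMost_iff)
  ultimately show ?thesis
    using a finite_joint_actions[OF m i] by (simp add: sum_nonneg_eq_0_iff)
next
  case False
  then have "pol i s k a = x i j s k a / (\<Sum>a\<in>joint_actions m i. x i j s k a)"
    using pol i s k a unfolding policy_given_by_def by auto
  then show ?thesis using False by simp
qed

text \<open>Makes \<open>prob_failure\<close> linear in \<open>x\<close>: \<open>alive 0\<close> is
  a point mass, and at every later time \<open>alive\<close> is replaced by the inflow, which makes
  sense up to the horizon although the plan stops one step earlier.\<close>

lemma prob_point_fails:
  fixes m :: "('v, 's, 'a, 'i, 'j::zero) model"
  assumes m: "valid_model m" and plan: "conditional_plan m x" and j: "j \<in> criteria m"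
    and pol: "policy_given_by m x j pol" and ex: "execution m pol j M S R" and i: "i \<in> points m"
  shows "\<P>(\<omega> in M. point_fails m R i \<omega>) = joint_risk m i j (joint_init m i) +
    (\<Sum>k=1..horizon m. \<Sum>s'\<in>joint_states m i. \<Sum>a\<in>joint_actions m i. \<Sum>s\<in>joint_states m i.
      joint_risk m i j s * x i j s' (k - 1) a * safe_trans m i j s' a s)"
proof -
  let ?h = "horizon m" and ?S = "joint_states m i" and ?A = "joint_actions m i"
    and ?g = "\<lambda>s. \<Prod>e\<in>pairs m i. 1 - pair_risk m j s e"
  let ?flow = "\<lambda>k s. \<Sum>s'\<in>?S. \<Sum>a\<in>?A. x i j s' k a * safe_trans m i j s' a s"
  interpret failing_chain M "run_at m S i" "\<lambda>t \<omega>. \<exists>e\<in>pairs m i. R t e \<omega>" ?S ?h "joint_init m i"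
      "\<lambda>k s s'. \<Sum>a\<in>?A. pol i s k a * joint_trans m i s a s'" ?g
    by (rule execution_failing_chain[OF m i ex])
  have j0: "j \<noteq> 0" using m j by (auto simp: valid_model_def)
  \<comment> \<open>The induction hypothesis is an assumption here, so that the same step serves
    inside the induction and afterwards, where it reaches time \<open>?h\<close>, at which the plan
    is unconstrained.\<close>
  have flow: "?flow k s = alive (Suc k) s"
    if k: "k < ?h" and s: "s \<in> ?S" and IH: "\<And>s. s \<in> ?S \<Longrightarrow> (\<Sum>a\<in>?A. x i j s k a) = alive k s" for k s
  proof -
    \<comment> \<open>As \<open>j \<noteq> 0\<close>, \<open>safe_trans\<close> contains the
      survival factor of the source state, which is \<open>?g s'\<close>.\<close>
    have "?flow k s = (\<Sum>s'\<in>?S. \<Sum>a\<in>?A. alive k s' * (?g s' * (pol i s' k a * joint_trans m i s' a s)))"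
    proof (intro sum.cong refl)
      fix s' a assume "s' \<in> ?S" "a \<in> ?A"
      then show "x i j s' k a * safe_trans m i j s' a s =
          alive k s' * (?g s' * (pol i s' k a * joint_trans m i s' a s))"
        using plan_eq_policy_mult[OF m plan j pol i _ k, of s' a] IH[of s'] j0
        by (simp add: safe_trans_def mult_ac)
    qed
    then show ?thesis
      by (simp add: alive_Suc[OF k s] sum_distrib_left)
  qed
  have plan_alive: "(\<Sum>a\<in>?A. x i j s k a) = alive k s" if "k < ?h" "s \<in> ?S" for k s
    using that
  proof (induction k arbitrary: s)
    \<comment> \<open>Normalisation gives mass 1 at the initial state and the support condition
      gives mass 0 elsewhere, matching \<open>alive_0\<close>.\<close>
    case 0
    show ?case
    proof (cases "s = joint_init m i")
      case True
      then show ?thesis using plan i j by (auto simp: alive_0 conditional_plan_def)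
    next
      case False
      have "\<forall>a\<in>?A. x i j s 0 a = 0"
        using False 0 plan i j unfolding conditional_plan_def by blast
      then show ?thesis using False by (simp add: alive_0)
    qed
  next
    case (Suc k)
    have "\<forall>k\<in>{1..?h - 1}. \<forall>s\<in>?S. (\<Sum>a\<in>?A. x i j s k a) = ?flow (k - 1) s"
      using plan i j unfolding conditional_plan_def by blast
    from bspec[OF bspec[OF this, of "Suc k"] Suc.prems(2)]
    have "(\<Sum>a\<in>?A. x i j s (Suc k) a) = ?flow k s"
      using Suc.prems(1) by simp
    also have "\<dots> = alive (Suc k) s"
      using Suc by (intro flow) auto
    finally show ?case .
  qed
  have risk: "1 - ?g s = joint_risk m i j s" for s
    by (simp add: joint_risk_def)
  have "\<P>(\<omega> in M. point_fails m R i \<omega>) = (\<Sum>k\<le>?h. \<Sum>s\<in>?S. alive k s * joint_risk m i j s)"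
    using prob_failure unfolding point_fails_def risk .
  \<comment> \<open>Time 0 is split off because no inflow leads to it.\<close>
  also have "\<dots> = (\<Sum>s\<in>?S. alive 0 s * joint_risk m i j s) +
      (\<Sum>k=1..?h. \<Sum>s\<in>?S. alive k s * joint_risk m i j s)"
    by (simp only: atMost_atLeast0 sum.atLeast_Suc_atMost[of 0] One_nat_def)
  also have "(\<Sum>s\<in>?S. alive 0 s * joint_risk m i j s) = joint_risk m i j (joint_init m i)"
    using joint_init_in[OF m i] finite_joint_states[OF m i]
    by (simp add: alive_0 if_distrib[of "\<lambda>c. c * _"] sum.delta' cong: if_cong)
  also have "(\<Sum>k=1..?h. \<Sum>s\<in>?S. alive k s * joint_risk m i j s) =
      (\<Sum>k=1..?h. \<Sum>s'\<in>?S. \<Sum>a\<in>?A. \<Sum>s\<in>?S.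
        joint_risk m i j s * x i j s' (k - 1) a * safe_trans m i j s' a s)"
  proof (rule sum.cong[OF refl])
    fix k assume k: "k \<in> {1..?h}"
    \<comment> \<open>The index \<open>k - 1\<close> stays below \<open>?h\<close> even for
      \<open>k = ?h\<close>.\<close>
    have "(\<Sum>s\<in>?S. alive k s * joint_risk m i j s) = (\<Sum>s\<in>?S. ?flow (k - 1) s * joint_risk m i j s)"
      using k flow[of "k - 1"] plan_alive[of "k - 1"] by (intro sum.cong refl) auto
    also have "\<dots> = (\<Sum>s\<in>?S. \<Sum>s'\<in>?S. \<Sum>a\<in>?A.
        joint_risk m i j s * x i j s' (k - 1) a * safe_trans m i j s' a s)"
      by (simp add: sum_distrib_left mult_ac)
    also have "\<dots> = (\<Sum>s'\<in>?S. \<Sum>s\<in>?S. \<Sum>a\<in>?A.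
        joint_risk m i j s * x i j s' (k - 1) a * safe_trans m i j s' a s)"
      by (rule sum.swap)
    also have "\<dots> = (\<Sum>s'\<in>?S. \<Sum>a\<in>?A. \<Sum>s\<in>?S.
        joint_risk m i j s * x i j s' (k - 1) a * safe_trans m i j s' a s)"
      by (intro sum.cong refl) (rule sum.swap)
    finally show "(\<Sum>s\<in>?S. alive k s * joint_risk m i j s) = \<dots>" .
  qed
  finally show ?thesis .
qed

section \<open>Additivity over the interaction points\<close>

text \<open>The conditioning event has probability 1, since the run at each point starts in its
  initial state almost surely and the points cover all agents. Exclusivity then turns the
  probability of the union into a sum.\<close>

lemma execution_risk_eq_sum:
  assumes m: "valid_model m" and ex: "execution m pol j M S R" and excl: "exclusive_failures m M R"
  shows "execution_risk m M S R = (\<Sum>i\<in>points m. \<P>(\<omega> in M. point_fails m R i \<omega>))"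
proof -
  interpret prob_space M using ex by (simp add: execution_def)
  let ?h = "horizon m"
  have fin: "finite (points m)" using m by (simp add: valid_model_def)
  have S_meas: "S 0 v \<in> M \<rightarrow>\<^sub>M count_space (states m v)" if "v \<in> agents m" for v
    using ex that by (auto simp: execution_def)
  have "\<forall>i\<in>points m. AE \<omega> in M. run_at m S i 0 \<omega> = joint_init m i"
    using ex by (auto simp: execution_def markov_run_def)
  then have "AE \<omega> in M. \<forall>i\<in>points m. run_at m S i 0 \<omega> = joint_init m i"
    by (simp add: AE_finite_all[OF fin])
  then have init: "AE \<omega> in M. \<forall>v\<in>agents m. S 0 v \<omega> = init m v"
  proof (rule eventually_mono)
    fix \<omega> assume run: "\<forall>i\<in>points m. run_at m S i 0 \<omega> = joint_init m i"
    show "\<forall>v\<in>agents m. S 0 v \<omega> = init m v"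
    proof
      fix v assume "v \<in> agents m"
      then obtain i where i: "i \<in> points m" "v \<in> members m i" using m by (auto simp: valid_model_def)
      then have "run_at m S i 0 \<omega> v = joint_init m i v" using run by simp
      then show "S 0 v \<omega> = init m v" using i by (simp add: run_at_def joint_init_def)
    qed
  qed
  have fails_meas: "{\<omega> \<in> space M. point_fails m R i \<omega>} \<in> events" if "i \<in> points m" for i
  proof -
    have "Measurable.pred M (\<lambda>\<omega>. \<exists>t\<in>{..?h}. \<exists>e\<in>pairs m i. R t e \<omega>)"
      using ex that finite_pairs[OF finite_members[OF m that]]
      by (intro pred_intros_finite) (auto simp: execution_def)
    then show ?thesis by (simp only: pred_def point_fails_def Bex_def atMost_iff)
  qed
  have union_meas: "{\<omega> \<in> space M. \<exists>i\<in>points m. point_fails m R i \<omega>} \<in> events"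
    using fails_meas fin by (rule sets.sets_Collect_finite_Ex)
  have init_meas: "{\<omega> \<in> space M. \<forall>v\<in>agents m. S 0 v \<omega> = init m v} \<in> events"
  proof -
    have "Measurable.pred M (\<lambda>\<omega>. \<forall>v\<in>agents m. S 0 v \<omega> = init m v)"
      using m by (intro pred_intros_finite pred_eq_const1[OF S_meas]) (auto simp: valid_model_def)
    then show ?thesis by (simp only: pred_def)
  qed
  have "execution_risk m M S R =
      \<P>(\<omega> in M. \<exists>i\<in>points m. point_fails m R i \<omega> \<bar> \<forall>v\<in>agents m. S 0 v \<omega> = init m v)"
    unfolding execution_risk_def point_fails_def
    by (intro arg_cong2[where f = "cond_prob M"] ext refl) blast
  also have "\<dots> = \<P>(\<omega> in M. \<exists>i\<in>points m. point_fails m R i \<omega>)"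
  proof -
    have "\<P>(\<omega> in M. (\<exists>i\<in>points m. point_fails m R i \<omega>) \<and> (\<forall>v\<in>agents m. S 0 v \<omega> = init m v)) =
        \<P>(\<omega> in M. \<exists>i\<in>points m. point_fails m R i \<omega>)"
      using init by (intro prob_eq_AE sets.sets_Collect_conj union_meas init_meas) auto
    moreover have "\<P>(\<omega> in M. \<forall>v\<in>agents m. S 0 v \<omega> = init m v) = 1"
      using init by (simp add: prob_Collect_eq_1[OF init_meas])
    ultimately show ?thesis by (simp add: cond_prob_def)
  qed
  also have "\<dots> = (\<Sum>i\<in>points m. \<P>(\<omega> in M. point_fails m R i \<omega>))"
  proof (rule prob_sum[OF fin fails_meas union_meas])
    \<comment> \<open>There are finitely many pairs of points, so their null sets combine into one.
      Outside it a failing point is unique, as \<open>prob_sum\<close> requires.\<close>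
    have "AE \<omega> in M. \<forall>i\<in>points m. \<forall>i'\<in>points m. i \<noteq> i' \<longrightarrow>
        \<not> (point_fails m R i \<omega> \<and> point_fails m R i' \<omega>)"
      using excl unfolding exclusive_failures_def
      by (intro AE_finite_allI[OF fin]) auto
    then show "AE \<omega> in M.
        (\<forall>i\<in>points m. point_fails m R i \<omega> \<longrightarrow> (\<exists>i\<in>points m. point_fails m R i \<omega>)) \<and>
        ((\<exists>i\<in>points m. point_fails m R i \<omega>) \<longrightarrow> (\<exists>!i. i \<in> points m \<and> point_fails m R i \<omega>))"
      by (rule eventually_mono) blast
  qed
  finally show ?thesis .
qed

theorem theorem1:
  fixes m :: "('v, 's, 'a, 'i, 'j::zero) model"
    and x :: "('v, 's, 'a, 'i, 'j) plan"
    and pol :: "('v, 's, 'a, 'i) policy"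
    and j :: 'j
    and M :: "'w measure"
    and S :: "nat \<Rightarrow> 'v \<Rightarrow> 'w \<Rightarrow> 's"
    and R :: "nat \<Rightarrow> 'v uprod \<Rightarrow> 'w \<Rightarrow> bool"
  assumes "valid_model m"
    and "conditional_plan m x"
    and "j \<in> criteria m"
    and "policy_given_by m x j pol"
    and "execution m pol j M S R"
    and "exclusive_failures m M R"
  shows "execution_risk m M S R =
           (\<Sum>i\<in>points m. joint_risk m i j (joint_init m i)) +
           (\<Sum>k=1..horizon m. \<Sum>i\<in>points m. \<Sum>s'\<in>joint_states m i.
              \<Sum>a\<in>joint_actions m i. \<Sum>s\<in>joint_states m i.
                joint_risk m i j s * x i j s' (k - 1) a * safe_trans m i j s' a s)"
  unfolding execution_risk_eq_sum[OF assms(1,5,6)]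
  \<comment> \<open>Exchanging times and points on the right makes the sum over points outermost, as
    it is on the left.\<close>
  by (subst sum.swap) (simp add: prob_point_fails[OF assms(1-5)] sum.distrib)

end
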